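(* Let $X$ be a Banach space over $\mathbb{K}$. If there are $x_0\in\operatorname{StrExp}(B_X)$ and $u_0\in\operatorname{Smooth}(X)$ such that $u_0\perp_B x_0$, then $X$ does not have numerical index one.
   Context: $\mathbb{K}$ is $\mathbb{R}$ or $\mathbb{C}$. $\operatorname{StrExp}(B_X)$ is the set of strongly exposed points of the closed unit ball $B_X$: $x_0\in B_X$ belongs to it if there is $f_0\in X^*$, $\|f_0\|=1$, such that whenever $\{x_n\}\subset B_X$ and $\lim\operatorname{Re}f_0(x_n)=1$, then $\lim x_n=x_0$ in norm. $\operatorname{Smooth}(X)$ is the set of smooth points of $X$, i.e. of $z\in X$ such that $\{\phi\in X^*\colon\|\phi\|=1,\ \phi(z)=\|z\|\}$ is a singleton. $x\perp_B y$ (Birkhoff-James orthogonality) means $\|x+\lambda y\|\geq\|x\|$ for all $\lambda\in\mathbb{K}$. For a bounded linear operator $T$ on $X$, the numerical radius is $v(T)=\sup\{|x^*(Tx)|\colon x\in X,\ x^*\in X^*,\ \|x\|=\|x^*\|=x^*(x)=1\}$, and the numerical index of $X$ is $n(X)=\inf\{v(T)\colon T\in\mathcal{L}(X),\ \|T\|=1\}$; $X$ has numerical index one if $n(X)=1$, i.e. $v(T)=\|T\|$ for all $T\in\mathcal{L}(X)$. *)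

theory Defs
  imports "HOL-Analysis.Analysis"
begin

text \<open>
  The scalar field \<open>K\<close>. The library has real, but no complex normed spaces, so the two
  cases are treated uniformly by a class whose members are exactly the isometric copies of
  the real and of the complex numbers.
\<close>

class real_or_complex = real_normed_field +
  fixes to_complex :: "'a \<Rightarrow> complex"
  assumes to_complex_add: "to_complex (a + b) = to_complex a + to_complex b"
    and to_complex_mult: "to_complex (a * b) = to_complex a * to_complex b"
    and to_complex_scaleR: "to_complex (r *\<^sub>R a) = r *\<^sub>R to_complex a"
    and norm_to_complex: "norm (to_complex a) = norm a"
    and range_to_complex: "range to_complex = \<real> \<or> range to_complex = UNIV"

instantiation real :: real_or_complex
begin

definition to_complex_real :: "real \<Rightarrow> complex"
  where "to_complex_real = complex_of_real"

instance
  by standard (simp_all add: to_complex_real_def Reals_def scaleR_conv_of_real)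

end

instantiation complex :: real_or_complex
begin

definition to_complex_complex :: "complex \<Rightarrow> complex"
  where "to_complex_complex = id"

instance
  by standard (simp_all add: to_complex_complex_def)

end

text \<open>
  A normed space over \<open>K\<close> is a real normed space in the sense of the library with a
  compatible multiplication by scalars from \<open>K\<close>. Completeness, being independent of the
  scalars, is expressed by the class \<open>banach\<close>.
\<close>

locale normed_space_over = vector_space smul
  for smul :: "'k::real_or_complex \<Rightarrow> 'a::real_normed_vector \<Rightarrow> 'a" +
  assumes smul_of_real: "smul (of_real r) x = r *\<^sub>R x"
    and norm_smul: "norm (smul c x) = norm c * norm x"

lemma normed_space_over_scaleR:
  "normed_space_over (scaleR :: real \<Rightarrow> 'a::real_normed_vector \<Rightarrow> 'a)"
  by standard (simp_all add: scaleR_add_right scaleR_add_left)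

lemma normed_space_over_times:
  "normed_space_over ((*) :: 'k::real_or_complex \<Rightarrow> 'k \<Rightarrow> 'k)"
  by standard (simp_all add: distrib_left distrib_right mult.assoc norm_mult scaleR_conv_of_real)

text \<open>The norm of \<open>dual\<close> and \<open>operators\<close> is \<open>onorm\<close>, as for real scalars.\<close>

definition dual :: "('k::real_or_complex \<Rightarrow> 'a::real_normed_vector \<Rightarrow> 'a) \<Rightarrow> ('a \<Rightarrow> 'k) set"
  where "dual smul = {f. Vector_Spaces.linear smul (*) f \<and> bounded_linear f}"

definition operators :: "('k::real_or_complex \<Rightarrow> 'a::real_normed_vector \<Rightarrow> 'a) \<Rightarrow> ('a \<Rightarrow> 'a) set"
  where "operators smul = {T. Vector_Spaces.linear smul smul T \<and> bounded_linear T}"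

definition strongly_exposed_points ::
    "('k::real_or_complex \<Rightarrow> 'a::real_normed_vector \<Rightarrow> 'a) \<Rightarrow> 'a set"
  where "strongly_exposed_points smul =
    {x0 \<in> cball 0 1. \<exists>f0 \<in> dual smul. onorm f0 = 1 \<and>
       (\<forall>x :: nat \<Rightarrow> 'a. range x \<subseteq> cball 0 1 \<longrightarrow>
          (\<lambda>n. Re (to_complex (f0 (x n)))) \<longlonglongrightarrow> 1 \<longrightarrow> x \<longlonglongrightarrow> x0)}"

definition smooth_points ::
    "('k::real_or_complex \<Rightarrow> 'a::real_normed_vector \<Rightarrow> 'a) \<Rightarrow> 'a set"
  where "smooth_points smul =
    {z. is_singleton {\<phi> \<in> dual smul. onorm \<phi> = 1 \<and> \<phi> z = of_real (norm z)}}"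

definition birkhoff_james_orthogonal ::
    "('k::real_or_complex \<Rightarrow> 'a::real_normed_vector \<Rightarrow> 'a) \<Rightarrow> 'a \<Rightarrow> 'a \<Rightarrow> bool"
  where "birkhoff_james_orthogonal smul x y \<longleftrightarrow> (\<forall>c. norm (x + smul c y) \<ge> norm x)"

text \<open>
  If the space is not trivial, the supremum and the infimum below are those of nonempty
  bounded sets; on the trivial space both sets are empty and the values carry no meaning.
\<close>

definition numerical_radius ::
    "('k::real_or_complex \<Rightarrow> 'a::real_normed_vector \<Rightarrow> 'a) \<Rightarrow> ('a \<Rightarrow> 'a) \<Rightarrow> real"
  where "numerical_radius smul T =
    Sup {norm (f (T x)) | x f. f \<in> dual smul \<and> norm x = 1 \<and> onorm f = 1 \<and> f x = 1}"

definition numerical_index ::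
    "('k::real_or_complex \<Rightarrow> 'a::real_normed_vector \<Rightarrow> 'a) \<Rightarrow> real"
  where "numerical_index smul =
    Inf {numerical_radius smul T | T. T \<in> operators smul \<and> onorm T = 1}"

end

(*
  If the numerical index is one and f0 strongly exposes x0, apply this to the rank-one
  operator f0(.) u0 / |u0|: there are states (x_n, f_n) with |f0(x_n)| -> 1 and
  |f_n(u0)| -> |u0|. Up to rotation x_n -> x0, so |f_n(x0)| -> 1 as well. A limit of rotated
  f_n on the span of u0 and x0, extended by Hahn-Banach, is a support functional at u0 that
  does not vanish at x0, whereas u0 being Birkhoff-James orthogonal to x0 provides one that
  does. So u0 is not smooth.
*)

theory Submission
  imports Defs
begin

section \<open>The Hahn--Banach theorem\<close>

definition sublinear :: "('a::real_vector \<Rightarrow> real) \<Rightarrow> bool"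
  where "sublinear p \<longleftrightarrow>
    (\<forall>x y. p (x + y) \<le> p x + p y) \<and> (\<forall>c x. 0 \<le> c \<longrightarrow> p (c *\<^sub>R x) \<le> c * p x)"

lemma sublinear_add: "sublinear p \<Longrightarrow> p (x + y) \<le> p x + p y"
  and sublinear_scaleR: "sublinear p \<Longrightarrow> 0 \<le> c \<Longrightarrow> p (c *\<^sub>R x) \<le> c * p x"
  by (simp_all add: sublinear_def)

lemma sublinear_zero: "sublinear p \<Longrightarrow> p 0 = 0"
  using sublinear_add[of p 0 0] sublinear_scaleR[of p 0 0] by simp

lemma sublinear_minus: "sublinear p \<Longrightarrow> - p (- x) \<le> p x"
  using sublinear_add[of p x "- x"] sublinear_zero[of p] by simp

lemma sublinear_norm: "sublinear norm"
  by (simp add: sublinear_def norm_triangle_ineq)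

text \<open>Subadditivity at \<open>x + y\<close> and \<open>- y\<close> reverses the inequality at
  \<open>x\<close> and \<open>y\<close>; in the same way the scaling inequality at
  \<open>- z\<close> reverses the one at \<open>z\<close>.\<close>

lemma sublinear_odd_imp_linear:
  assumes q: "sublinear q" and odd: "\<And>x. q (- x) = - q x"
  shows "linear q"
proof (rule linearI)
  fix x y :: 'a and c :: real
  show "q (x + y) = q x + q y"
    using sublinear_add[OF q, of x y] sublinear_add[OF q, of "x + y" "- y"] odd[of y] by simp
  have pos: "q (c *\<^sub>R z) = c * q z" if "0 \<le> c" for c z
    using sublinear_scaleR[OF q that, of z] sublinear_scaleR[OF q that, of "- z"]
      odd[of "c *\<^sub>R z"] odd[of z] by simp
  show "q (c *\<^sub>R x) = c *\<^sub>R q x"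
    using pos[of c x] pos[of "- c" x] odd[of "c *\<^sub>R x"] by (cases "0 \<le> c") auto
qed

text \<open>The functional \<open>r\<close> is an infimal convolution; the linear functionals below it are those below \<open>p\<close> that
  dominate \<open>t\<close> at \<open>y\<close> for all \<open>(y, t) \<in> K\<close>.\<close>

lemma sublinear_below_cone:
  fixes p :: "'a::real_vector \<Rightarrow> real" and K :: "('a \<times> real) set"
  assumes p: "sublinear p" and ne: "(0, 0) \<in> K"
    and add: "\<And>k l. k \<in> K \<Longrightarrow> l \<in> K \<Longrightarrow> k + l \<in> K"
    and scale: "\<And>k c. k \<in> K \<Longrightarrow> 0 \<le> c \<Longrightarrow> c *\<^sub>R k \<in> K"
    and le: "\<And>k. k \<in> K \<Longrightarrow> snd k \<le> p (fst k)"
  obtains r where "sublinear r" "r \<le> p" "\<And>k. k \<in> K \<Longrightarrow> r (- fst k) \<le> - snd k"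
proof -
  define r where "r x = (INF k\<in>K. p (x + fst k) - snd k)" for x
  \<comment> \<open>The infimum is finite: splitting \<open>fst k\<close> as
    \<open>(x + fst k) + (- x)\<close> gives a lower bound that does not depend on
    \<open>k\<close>.\<close>
  have bdd: "bdd_below ((\<lambda>k. p (x + fst k) - snd k) ` K)" for x
  proof (rule bdd_belowI2)
    fix k assume "k \<in> K"
    then show "- p (- x) \<le> p (x + fst k) - snd k"
      using sublinear_add[OF p, of "x + fst k" "- x"] le[of k] by simp
  qed
  have lower: "r x \<le> p (x + fst k) - snd k" if "k \<in> K" for x k
    unfolding r_def by (rule cINF_lower[OF bdd that])
  have greatest: "z \<le> r x" if "\<And>k. k \<in> K \<Longrightarrow> z \<le> p (x + fst k) - snd k" for x z
    unfolding r_def using ne that by (intro cINF_greatest) auto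
  have rp: "r x \<le> p x" for x
    using lower[OF ne, of x] by simp
  have "sublinear r"
    unfolding sublinear_def
  proof (intro conjI allI impI)
    fix x y
    \<comment> \<open>The infima over \<open>k\<close> and \<open>l\<close> are taken one at a time;
      \<open>k + l\<close> competes in the infimum that defines \<open>r (x + y)\<close>.\<close>
    have "r (x + y) - r y \<le> p (x + fst k) - snd k" if k: "k \<in> K" for k
    proof -
      have "r (x + y) - (p (x + fst k) - snd k) \<le> r y"
      proof (rule greatest)
        fix l assume l: "l \<in> K"
        have "r (x + y) \<le> p ((x + fst k) + (y + fst l)) - (snd k + snd l)"
          using lower[OF add[OF k l], of "x + y"] by (simp add: algebra_simps)
        then show "r (x + y) - (p (x + fst k) - snd k) \<le> p (y + fst l) - snd l"
          using sublinear_add[OF p, of "x + fst k" "y + fst l"] by simp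
      qed
      then show ?thesis by simp
    qed
    from greatest[OF this] show "r (x + y) \<le> r x + r y" by simp
  next
    fix c :: real and x assume c: "0 \<le> c"
    show "r (c *\<^sub>R x) \<le> c * r x"
    proof (cases "c = 0")
      case True
      then show ?thesis using rp[of 0] sublinear_zero[OF p] by simp
    next
      case False
      with c have pos: "c > 0" by simp
      have "r (c *\<^sub>R x) / c \<le> r x"
      proof (rule greatest)
        fix k assume k: "k \<in> K"
        have "r (c *\<^sub>R x) \<le> p (c *\<^sub>R (x + fst k)) - c * snd k"
          using lower[OF scale[OF k c], of "c *\<^sub>R x"] by (simp add: scaleR_add_right)
        also have "\<dots> \<le> c * (p (x + fst k) - snd k)"
          using sublinear_scaleR[OF p c, of "x + fst k"] by (simp add: right_diff_distrib)
        finally show "r (c *\<^sub>R x) / c \<le> p (x + fst k) - snd k"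
          using pos by (simp add: pos_divide_le_eq mult.commute)
      qed
      then show ?thesis using pos by (simp add: pos_divide_le_eq mult.commute)
    qed
  qed
  moreover have "r (- fst k) \<le> - snd k" if "k \<in> K" for k
    using lower[OF that, of "- fst k"] sublinear_zero[OF p] by simp
  ultimately show thesis using that rp by (simp add: le_fun_def)
qed

text \<open>The pointwise infimum works. It is finite because
  \<open>q x \<ge> - q (- x) \<ge> - p (- x)\<close>, and subadditive because the smaller of any two
  members of the chain serves both arguments.\<close>

lemma sublinear_INF_chain:
  fixes p :: "'a::real_vector \<Rightarrow> real"
  assumes C: "C \<noteq> {}" "\<And>q. q \<in> C \<Longrightarrow> sublinear q \<and> q \<le> p"
    and chain: "\<And>q r. q \<in> C \<Longrightarrow> r \<in> C \<Longrightarrow> q \<le> r \<or> r \<le> q"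
  obtains u where "sublinear u" "\<And>q. q \<in> C \<Longrightarrow> u \<le> q"
proof -
  define u where "u x = (INF q\<in>C. q x)" for x
  have bdd: "bdd_below ((\<lambda>q. q x) ` C)" for x
  proof (rule bdd_belowI2)
    fix q assume "q \<in> C"
    from C(2)[OF this] have "- q (- x) \<le> q x" "q (- x) \<le> p (- x)"
      by (simp_all add: sublinear_minus le_fun_def)
    then show "- p (- x) \<le> q x" by simp
  qed
  have lower: "u x \<le> q x" if "q \<in> C" for x q
    unfolding u_def by (rule cINF_lower[OF bdd that])
  have greatest: "z \<le> u x" if "\<And>q. q \<in> C \<Longrightarrow> z \<le> q x" for x z
    unfolding u_def using C(1) that by (intro cINF_greatest) auto
  have "sublinear u"
    unfolding sublinear_def
  proof (intro conjI allI impI)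
    fix x y
    have *: "u (x + y) \<le> q x + r y" if qr: "q \<in> C" "r \<in> C" for q r
    proof -
      obtain m where m: "m \<in> C" "m \<le> q" "m \<le> r"
        using chain[OF qr] qr by blast
      have "u (x + y) \<le> m x + m y"
        using lower[OF m(1), of "x + y"] sublinear_add[of m x y] C(2)[OF m(1)] by simp
      also have "\<dots> \<le> q x + r y"
        using m by (simp add: le_fun_def add_mono)
      finally show ?thesis .
    qed
    have "u (x + y) - u y \<le> q x" if q: "q \<in> C" for q
      using greatest[of "u (x + y) - q x" y] *[OF q] by (simp add: algebra_simps)
    then show "u (x + y) \<le> u x + u y"
      using greatest[of "u (x + y) - u y" x] by simp
  next
    fix c :: real and x assume c: "0 \<le> c"
    have *: "u (c *\<^sub>R x) \<le> c * q x" if "q \<in> C" for q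
      using lower[OF that, of "c *\<^sub>R x"] sublinear_scaleR[OF _ c, of q x] C(2)[OF that] by simp
    show "u (c *\<^sub>R x) \<le> c * u x"
    proof (cases "c = 0")
      case True
      then show ?thesis using * C(1) by auto
    next
      case False
      with c have pos: "c > 0" by simp
      have "u (c *\<^sub>R x) / c \<le> u x"
        using * pos by (intro greatest) (simp add: pos_divide_le_eq mult.commute)
      then show ?thesis using pos by (simp add: pos_divide_le_eq mult.commute)
    qed
  qed
  then show thesis using that lower by (simp add: le_fun_def)
qed

text \<open>Zorn's lemma gives a minimal sublinear functional below \<open>p\<close>; minimality
  makes it odd, and odd sublinear functionals are linear.\<close>

lemma linear_below_sublinear:
  fixes p :: "'a::real_vector \<Rightarrow> real"
  assumes p: "sublinear p"
  obtains f where "linear f" "f \<le> p"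
proof -
  define A where "A = {q. sublinear q \<and> q \<le> p}"
  \<comment> \<open>The order is reversed, so a maximal element in the sense of Zorn's lemma is a
    minimal functional.\<close>
  have "\<exists>m\<in>A. \<forall>a\<in>A. a \<le> m \<longrightarrow> a = m"
  proof (rule predicate_Zorn)
    show "partial_order_on A (relation_of (\<lambda>x y. y \<le> x) A)"
      by (auto simp: partial_order_on_def preorder_on_def refl_on_def trans_def antisym_def
          relation_of_def)
    fix C assume "C \<in> Chains (relation_of (\<lambda>x y. y \<le> x) A)"
    then have C: "C \<subseteq> A" "\<And>q r. q \<in> C \<Longrightarrow> r \<in> C \<Longrightarrow> q \<le> r \<or> r \<le> q"
      by (auto simp: Chains_def relation_of_def)
    show "\<exists>u\<in>A. \<forall>a\<in>C. u \<le> a"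
    \<comment> \<open>The empty chain is bounded by \<open>p\<close> itself, an infimum over no
      functionals being meaningless.\<close>
    proof (cases "C = {}")
      case True
      then show ?thesis using p by (auto simp: A_def)
    next
      case False
      obtain u where u: "sublinear u" "\<And>q. q \<in> C \<Longrightarrow> u \<le> q"
        using sublinear_INF_chain[of C p] False C by (auto simp: A_def)
      moreover obtain q where "q \<in> C" "q \<le> p"
        using False C(1) by (auto simp: A_def)
      then have "u \<le> p"
        using u(2)[of q] by simp
      ultimately show ?thesis by (auto simp: A_def)
    qed
  qed
  then obtain q where q: "sublinear q" "q \<le> p"
    and minimal: "\<And>r. sublinear r \<Longrightarrow> r \<le> p \<Longrightarrow> r \<le> q \<Longrightarrow> r = q"
    by (auto simp: A_def)
  \<comment> \<open>A linear functional below \<open>q\<close> should attain \<open>q\<close> at \<open>y\<close>; imposing this does not lower \<open>q\<close>.\<close>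
  have "q (- y) \<le> - q y" for y
  proof -
    define K where "K = (\<lambda>t. (t *\<^sub>R y, t * q y)) ` {0..}"
    obtain r where r: "sublinear r" "r \<le> q" "\<And>k. k \<in> K \<Longrightarrow> r (- fst k) \<le> - snd k"
    proof (rule sublinear_below_cone[OF q(1), of K])
      show "(0, 0) \<in> K" by (force simp: K_def)
      show "k + l \<in> K" if "k \<in> K" "l \<in> K" for k l
      proof -
        from that obtain s t where st: "0 \<le> s" "k = (s *\<^sub>R y, s * q y)" "0 \<le> t" "l = (t *\<^sub>R y, t * q y)"
          by (auto simp: K_def)
        then show ?thesis unfolding K_def
          by (intro image_eqI[where x="s + t"]) (auto simp: algebra_simps)
      qed
      show "c *\<^sub>R k \<in> K" if "k \<in> K" "0 \<le> c" for k and c :: real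
      proof -
        from that obtain s where "0 \<le> s" "k = (s *\<^sub>R y, s * q y)"
          by (auto simp: K_def)
        then show ?thesis using that(2) unfolding K_def
          by (intro image_eqI[where x="c * s"]) auto
      qed
      show "snd k \<le> q (fst k)" if kK: "k \<in> K" for k
      proof -
        from kK obtain s where s: "0 \<le> s" "k = (s *\<^sub>R y, s * q y)"
          by (auto simp: K_def)
        \<comment> \<open>The reverse of the scaling inequality, obtained by scaling
          \<open>s *\<^sub>R y\<close> back by \<open>inverse s\<close>.\<close>
        have "s * q y \<le> q (s *\<^sub>R y)"
        proof (cases "s = 0")
          case True
          then show ?thesis using sublinear_zero[OF q(1)] by simp
        next
          case False
          then have "q y \<le> inverse s * q (s *\<^sub>R y)"
            using sublinear_scaleR[OF q(1), of "inverse s" "s *\<^sub>R y"] s by simp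
          then show ?thesis using False s by (simp add: field_simps)
        qed
        then show ?thesis using s by simp
      qed
    qed (use that in blast)
    have "(y, q y) \<in> K" by (force simp: K_def)
    \<comment> \<open>By minimality \<open>r = q\<close>, so the bound on \<open>r\<close> at the
      generator of the ray is the bound on \<open>q\<close>.\<close>
    then show ?thesis using r(3)[of "(y, q y)"] minimal[OF r(1) order_trans[OF r(2) q(2)] r(2)] by simp
  qed
  with sublinear_minus[OF q(1)] have "q (- y) = - q y" for y
    by (metis add.inverse_inverse antisym)
  then show thesis using sublinear_odd_imp_linear[OF q(1)] q(2) that by blast
qed

text \<open>The subspace on which the functional is prescribed is given as the range of \<open>L\<close>.\<close>

theorem Hahn_Banach_real:
  fixes p :: "'a::real_vector \<Rightarrow> real" and L :: "'b::real_vector \<Rightarrow> 'a" and g :: "'b \<Rightarrow> real"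
  assumes p: "sublinear p" and L: "linear L" and g: "linear g" and le: "\<And>b. g b \<le> p (L b)"
  obtains f where "linear f" "f \<le> p" "\<And>b. f (L b) = g b"
proof -
  define K where "K = range (\<lambda>b. (L b, g b))"
  obtain r where r: "sublinear r" "r \<le> p" "\<And>k. k \<in> K \<Longrightarrow> r (- fst k) \<le> - snd k"
  proof (rule sublinear_below_cone[OF p, of K])
    show "(0, 0) \<in> K"
      unfolding K_def by (rule range_eqI[where x=0]) (simp add: linear_0[OF L] linear_0[OF g])
    show "k + l \<in> K" if kl: "k \<in> K" "l \<in> K" for k l
    proof -
      from kl obtain a b where "k = (L a, g a)" "l = (L b, g b)" by (auto simp: K_def)
      then show ?thesis unfolding K_def
        by (intro range_eqI[where x="a + b"]) (simp add: linear_add[OF L] linear_add[OF g])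
    qed
    show "c *\<^sub>R k \<in> K" if kK: "k \<in> K" for k and c :: real
    proof -
      from kK obtain a where "k = (L a, g a)" by (auto simp: K_def)
      then show ?thesis unfolding K_def
        by (intro range_eqI[where x="c *\<^sub>R a"]) (simp add: linear_scale[OF L] linear_scale[OF g])
    qed
    show "snd k \<le> p (fst k)" if "k \<in> K" for k
      using that le by (auto simp: K_def)
  qed (use that in blast)
  obtain f where f: "linear f" "f \<le> r"
    using linear_below_sublinear[OF r(1)] by blast
  have ge: "g b \<le> f (L b)" for b
  proof -
    have "f (- L b) \<le> - g b"
      using r(3)[of "(L b, g b)"] le_funD[OF f(2), of "- L b"] by (force simp: K_def)
    then show ?thesis by (simp add: linear_neg[OF f(1)])
  qed
  \<comment> \<open>The graph of \<open>g\<close> is closed under negation, so the one-sided bound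
    at \<open>b\<close> and at \<open>- b\<close> forces equality.\<close>
  have "f (L b) = g b" for b
    using ge[of b] ge[of "- b"]
    by (simp add: linear_neg[OF f(1)] linear_neg[OF L] linear_neg[OF g])
  then show thesis using that f r(2) by (meson order_trans)
qed


section \<open>Functionals over the scalar field\<close>

lemma to_complex_of_real: "to_complex (of_real r :: 'k::real_or_complex) = complex_of_real r"
proof -
  \<comment> \<open>\<open>to_complex 1\<close> is idempotent and, having norm one, nonzero; hence
    it is \<open>1\<close>.\<close>
  have "to_complex (1::'k) * to_complex (1::'k) = to_complex (1::'k) * 1" "to_complex (1::'k) \<noteq> 0"
    using to_complex_mult[of "1::'k" 1] norm_to_complex[of "1::'k"] by auto
  then have "to_complex (1::'k) = 1"
    using mult_left_cancel by blast
  then show ?thesis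
    using to_complex_scaleR[of r "1::'k"] by (simp add: scaleR_conv_of_real)
qed

lemma to_complex_diff: "to_complex (a - b) = to_complex a - to_complex b"
  using to_complex_add[of "a - b" b] by simp

lemma bounded_linear_to_complex: "bounded_linear (to_complex :: 'k::real_or_complex \<Rightarrow> complex)"
  by (rule bounded_linear_intro[where K=1])
    (simp_all add: to_complex_add to_complex_scaleR norm_to_complex)

lemma to_complex_eq_iff: "to_complex a = to_complex b \<longleftrightarrow> a = b"
  using norm_to_complex[of "a - b"] by (auto simp: to_complex_diff)

lemma ex_rotation:
  fixes z :: "'k::real_normed_field"
  obtains c where "norm c = 1" "c * z = of_real (norm z)"
proof (cases "z = 0")
  case True
  then show thesis using that[of 1] by simp
next
  case False
  then show thesis using that[of "of_real (norm z) / z"] by (simp add: norm_divide)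
qed

text \<open>Rotating \<open>z - w\<close> onto the nonnegative reals turns its real part into its
  norm. Identities between scalars can thus be checked on the real parts of all multiples.\<close>

lemma functional_value_unique:
  fixes z w :: "'k::real_or_complex"
  assumes "\<And>c. Re (to_complex (c * z)) = Re (to_complex (c * w))"
  shows "z = w"
proof -
  obtain c where c: "c * (z - w) = of_real (norm (z - w))"
    using ex_rotation by blast
  have "Re (to_complex (c * (z - w))) = 0"
    using assms[of c] by (simp add: right_diff_distrib to_complex_diff)
  then show ?thesis by (simp add: c to_complex_of_real)
qed

text \<open>Bolzano-Weierstrass in the complex numbers; the limit comes back because
  \<open>to_complex\<close> is isometric with closed range.\<close>

lemma real_or_complex_bounded_subsequence:
  fixes z :: "nat \<Rightarrow> 'k::real_or_complex"
  assumes "\<And>n. norm (z n) \<le> B"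
  obtains s l where "strict_mono s" "(\<lambda>n. z (s n)) \<longlonglongrightarrow> l"
proof -
  have "bounded (range (\<lambda>n. to_complex (z n)))"
    using assms by (auto simp: bounded_iff norm_to_complex)
  then obtain w s where s: "strict_mono s" and w: "(\<lambda>n. to_complex (z (s n))) \<longlonglongrightarrow> w"
    using bounded_imp_convergent_subsequence[of "\<lambda>n. to_complex (z n)"] by (auto simp: o_def)
  have "closed (range (to_complex :: 'k \<Rightarrow> complex))"
    using range_to_complex closed_complex_Reals by (metis closed_UNIV)
  then have "w \<in> range (to_complex :: 'k \<Rightarrow> complex)"
    using closed_sequentially[OF _ _ w] by blast
  then obtain l :: 'k where l: "w = to_complex l" by blast
  have "(\<lambda>n. norm (to_complex (z (s n)) - w)) \<longlonglongrightarrow> 0"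
    by (intro tendsto_norm_zero LIM_zero w)
  then have "(\<lambda>n. norm (z (s n) - l)) \<longlonglongrightarrow> 0"
    by (simp add: l norm_to_complex flip: to_complex_diff)
  then have "(\<lambda>n. z (s n)) \<longlonglongrightarrow> l"
    by (simp add: tendsto_norm_zero_iff LIM_zero_iff)
  then show thesis using that s by blast
qed

lemma onorm_le_one: "(\<And>x. norm (f x) \<le> norm x) \<Longrightarrow> onorm f \<le> 1"
  by (rule onorm_bound) auto

section \<open>Dual functionals and their construction from real parts and from two values\<close>

context normed_space_over
begin

lemma smul_scaleR_left: "smul (r *\<^sub>R a) x = r *\<^sub>R smul a x"
  by (simp add: scaleR_conv_of_real smul_of_real flip: scale_scale)

lemma dual_iff:
  "f \<in> dual smul \<longleftrightarrow>
    (\<forall>x y. f (x + y) = f x + f y) \<and> (\<forall>c x. f (smul c x) = c * f x) \<and> bounded_linear f"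
proof -
  have "vector_space ((*) :: 'k \<Rightarrow> 'k \<Rightarrow> 'k)"
    by standard (simp_all add: algebra_simps)
  then show ?thesis
    using vector_space_axioms
    by (auto simp: dual_def Vector_Spaces.linear_def module_hom_iff vector_space_def module_def)
qed

lemma dual_norm_le:
  assumes "f \<in> dual smul" "onorm f \<le> 1"
  shows "norm (f x) \<le> norm x"
  using onorm[of f x] assms mult_right_mono[of "onorm f" 1 "norm x"] by (simp add: dual_iff)

lemma dual_onorm_eq_oneI:
  assumes "f \<in> dual smul" "\<And>x. norm (f x) \<le> norm x" "norm (f z) = norm z" "z \<noteq> 0"
  shows "onorm f = 1"
proof (rule antisym)
  show "onorm f \<le> 1" by (rule onorm_le_one[OF assms(2)])
  show "1 \<le> onorm f"
    using onorm[of f z] assms by (simp add: dual_iff)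
qed

text \<open>\<open>z\<close> is the value at \<open>x\<close> of the scalar-linear functional with
  real part \<open>F\<close>: the classical \<open>F x - i F (i x)\<close> over the complex numbers,
  \<open>F x\<close> itself over the reals.\<close>

lemma ex_functional_value:
  assumes F: "linear F"
  obtains z where "\<And>c. Re (to_complex (c * z)) = F (smul c x)"
proof (cases "range (to_complex :: 'k \<Rightarrow> complex) = UNIV")
  case True
  then obtain j :: 'k where j: "to_complex j = \<i>" by (metis surjD)
  have "Re (to_complex (c * (of_real (F x) - j * of_real (F (smul j x))))) = F (smul c x)" for c
  proof -
    have "to_complex c = to_complex (of_real (Re (to_complex c)) + j * of_real (Im (to_complex c)))"
      by (simp add: to_complex_add to_complex_mult to_complex_of_real j flip: complex_eq)
    then have "c = Re (to_complex c) *\<^sub>R 1 + Im (to_complex c) *\<^sub>R j"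
      by (simp only: to_complex_eq_iff) (simp add: scaleR_conv_of_real mult.commute)
    then have "smul c x = Re (to_complex c) *\<^sub>R x + Im (to_complex c) *\<^sub>R smul j x"
      by (metis scale_left_distrib scale_one smul_scaleR_left)
    then show ?thesis
      by (simp add: linear_add[OF F] linear_scale[OF F] to_complex_diff to_complex_mult
          to_complex_of_real j algebra_simps)
  qed
  then show thesis using that by blast
next
  case False
  have "Re (to_complex (c * of_real (F x))) = F (smul c x)" for c
  proof -
    have "to_complex c \<in> \<real>"
      using False range_to_complex by blast
    then have "to_complex c = to_complex (of_real (Re (to_complex c)) :: 'k)"
      by (auto simp: to_complex_of_real elim: Reals_cases)
    then have "c = of_real (Re (to_complex c))"
      by (simp only: to_complex_eq_iff)
    then have "smul c x = Re (to_complex c) *\<^sub>R x"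
      by (metis smul_of_real)
    then show ?thesis
      by (simp add: linear_scale[OF F] to_complex_mult to_complex_of_real)
  qed
  then show thesis using that by blast
qed

lemma dual_from_real_part:
  assumes F: "linear F" and le: "F \<le> norm"
  obtains f where "f \<in> dual smul" "\<And>x. norm (f x) \<le> norm x" "\<And>x. Re (to_complex (f x)) = F x"
proof -
  \<comment> \<open>The chosen value is determined by this property, so additivity and homogeneity
    of \<open>f\<close> follow from \<open>functional_value_unique\<close>.\<close>
  define f where "f x = (SOME z. \<forall>c. Re (to_complex (c * z)) = F (smul c x))" for x
  have f: "Re (to_complex (c * f x)) = F (smul c x)" for c x
  proof -
    have "\<exists>z. \<forall>c. Re (to_complex (c * z)) = F (smul c x)"
      using ex_functional_value[OF F] by metis
    from someI_ex[OF this] show ?thesis by (simp add: f_def)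
  qed
  have add: "f (x + y) = f x + f y" for x y
    by (rule functional_value_unique)
      (simp add: f distrib_left to_complex_add scale_right_distrib linear_add[OF F])
  have scale: "f (smul a x) = a * f x" for a x
    by (rule functional_value_unique) (simp add: f flip: mult.assoc)
  have bound: "norm (f x) \<le> norm x" for x
  proof -
    \<comment> \<open>After this rotation the value is real, so the bound on the real part
      \<open>F\<close> controls the full norm of \<open>f x\<close>.\<close>
    obtain c where c: "norm c = 1" "c * f x = of_real (norm (f x))"
      using ex_rotation by blast
    have "norm (f x) = F (smul c x)"
      using f[of c x] by (simp add: c to_complex_of_real)
    also have "\<dots> \<le> norm x"
      using le_funD[OF le, of "smul c x"] by (simp add: norm_smul c)
    finally show ?thesis .
  qed
  have "bounded_linear f"
  proof (rule bounded_linear_intro[where K=1])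
    show "f (r *\<^sub>R x) = r *\<^sub>R f x" for r x
      using scale[of "of_real r" x] by (simp add: smul_of_real scaleR_conv_of_real)
  qed (simp_all add: add bound)
  then have "f \<in> dual smul" by (simp add: dual_iff add scale)
  then show thesis using that bound f[of 1] by auto
qed

text \<open>The hypothesis says that sending \<open>u\<close> to \<alpha> and \<open>v\<close> to
  \<beta> is well defined and of norm at most one on their span, even if \<open>u\<close> and
  \<open>v\<close> are dependent. The real part is extended by Hahn-Banach, and the functional is
  recovered from it.\<close>

lemma ex_dual_two_values:
  assumes le: "\<And>a b. norm (a * \<alpha> + b * \<beta>) \<le> norm (smul a u + smul b v)"
  obtains f where "f \<in> dual smul" "\<And>x. norm (f x) \<le> norm x" "f u = \<alpha>" "f v = \<beta>"
proof -
  define L where "L = (\<lambda>(a, b). smul a u + smul b v)"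
  define g where "g = (\<lambda>(a, b). Re (to_complex (a * \<alpha> + b * \<beta>)))"
  have L: "linear L"
    by (rule linearI)
      (simp_all add: L_def case_prod_unfold scale_left_distrib smul_scaleR_left scaleR_add_right)
  have g: "linear g"
    by (rule linearI)
      (simp_all add: g_def case_prod_unfold to_complex_add to_complex_mult to_complex_scaleR
        distrib_right right_diff_distrib mult.assoc distrib_left)
  have gL: "g k \<le> norm (L k)" for k
  proof -
    have "g k \<le> norm (fst k * \<alpha> + snd k * \<beta>)"
      using complex_Re_le_cmod[of "to_complex (fst k * \<alpha> + snd k * \<beta>)"]
      by (simp add: g_def case_prod_unfold norm_to_complex)
    also have "\<dots> \<le> norm (L k)"
      using le by (simp add: L_def case_prod_unfold)
    finally show ?thesis .
  qed
  obtain F where F: "linear F" "F \<le> norm" "\<And>k. F (L k) = g k"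
    using Hahn_Banach_real[OF sublinear_norm L g gL] by blast
  obtain f where f: "f \<in> dual smul" "\<And>x. norm (f x) \<le> norm x" "\<And>x. Re (to_complex (f x)) = F x"
    using dual_from_real_part[OF F(1,2)] by blast
  have f_smul: "Re (to_complex (c * f x)) = F (smul c x)" for c x
    using f(1) f(3)[of "smul c x"] by (simp add: dual_iff)
  have "f u = \<alpha>"
  proof (rule functional_value_unique)
    show "Re (to_complex (c * f u)) = Re (to_complex (c * \<alpha>))" for c
      using F(3)[of "(c, 0)"] by (simp add: f_smul L_def g_def)
  qed
  moreover have "f v = \<beta>"
  proof (rule functional_value_unique)
    show "Re (to_complex (c * f v)) = Re (to_complex (c * \<beta>))" for c
      using F(3)[of "(0, c)"] by (simp add: f_smul L_def g_def)
  qed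
  ultimately show thesis using that f by blast
qed

section \<open>Support functionals and the numerical radius\<close>

text \<open>Orthogonality bounds by the norm the functional on the span of \<open>u\<close> and
  \<open>v\<close> with values \<open>norm u\<close> and \<open>0\<close>, so it extends.\<close>

lemma birkhoff_james_support:
  assumes "birkhoff_james_orthogonal smul u v" "u \<noteq> 0"
  obtains f where "f \<in> dual smul" "onorm f = 1" "f u = of_real (norm u)" "f v = 0"
proof -
  have "norm (a * of_real (norm u) + b * 0) \<le> norm (smul a u + smul b v)" for a b
  proof (cases "a = 0")
    case False
    \<comment> \<open>Homogeneity reduces the bound to the orthogonality inequality at the scalar
      \<open>b / a\<close>.\<close>
    have "norm u \<le> norm (u + smul (b / a) v)"
      using assms(1) by (simp add: birkhoff_james_orthogonal_def)
    then have "norm a * norm u \<le> norm (smul a (u + smul (b / a) v))"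
      by (simp add: norm_smul mult_left_mono)
    then show ?thesis
      using False by (simp add: norm_mult scale_right_distrib)
  qed simp
  from ex_dual_two_values[OF this] obtain f where f: "f \<in> dual smul"
      "\<And>x. norm (f x) \<le> norm x" "f u = of_real (norm u)" "f v = 0"
    by metis
  have "onorm f = 1"
    by (rule dual_onorm_eq_oneI[OF f(1,2) _ assms(2)]) (simp add: f(3))
  with f that show thesis by blast
qed

text \<open>At the origin the condition on the value is void, so all functionals of norm one
  qualify; they are closed under negation, and none equals its negative.\<close>

lemma smooth_point_nonzero:
  assumes "u \<in> smooth_points smul"
  shows "u \<noteq> 0"
proof
  assume "u = 0"
  with assms obtain f where f: "{\<phi> \<in> dual smul. onorm \<phi> = 1 \<and> \<phi> 0 = 0} = {f}"
    by (auto simp: smooth_points_def is_singleton_def)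
  then have f1: "f \<in> dual smul" "onorm f = 1" "f 0 = 0" by blast+
  then have "(\<lambda>x. - f x) \<in> dual smul"
    by (simp add: dual_iff bounded_linear_minus)
  moreover have "onorm (\<lambda>x. - f x) = 1"
    using f1(2) by (simp add: onorm_neg)
  ultimately have "(\<lambda>x. - f x) \<in> {f}"
    using f1(3) by (simp flip: f)
  then have neg: "- f x = f x" for x
    by (metis singletonD)
  have "f x = 0" for x
  proof -
    have "2 * f x = f x + - f x" by (simp only: neg mult_2)
    then show ?thesis by simp
  qed
  then have "f = (\<lambda>x. 0)" by blast
  with f1(2) show False by (simp add: onorm_zero)
qed

lemma dual_almost_norming:
  assumes f: "f \<in> dual smul" "onorm f = 1" and r: "0 \<le> r" "r < 1"
  obtains x where "norm x \<le> 1" "r < Re (to_complex (f x))"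
proof -
  \<comment> \<open>Otherwise \<open>onorm f \<le> r < 1\<close>.\<close>
  have "\<exists>z. \<not> norm (f z) \<le> r * norm z"
    using onorm_bound[OF r(1), of f] f(2) r(2) by fastforce
  then obtain z where z: "r * norm z < norm (f z)" by (auto simp: not_le)
  have nz: "z \<noteq> 0"
    using z f(1) linear_0[OF bounded_linear.linear, of f] by (auto simp: dual_iff)
  obtain c where c: "norm c = 1" "c * f z = of_real (norm (f z))"
    using ex_rotation by blast
  \<comment> \<open>\<open>z\<close> normalised and rotated, so that the value of \<open>f\<close>
    becomes real and positive.\<close>
  define x where "x = smul (of_real (inverse (norm z)) * c) z"
  have "f x = of_real (inverse (norm z)) * (c * f z)"
    using f(1) by (simp add: x_def dual_iff)
  also have "\<dots> = of_real (inverse (norm z) * norm (f z))"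
    by (simp only: c of_real_mult)
  finally have "Re (to_complex (f x)) = inverse (norm z) * norm (f z)"
    by (simp only: to_complex_of_real Re_complex_of_real)
  then have "r < Re (to_complex (f x))"
    using z nz by (simp add: pos_less_divide_eq divide_inverse_commute[symmetric])
  moreover have "norm x \<le> 1"
    using nz by (simp add: x_def norm_smul norm_mult c norm_inverse)
  ultimately show thesis using that by blast
qed

text \<open>\<open>norm x0 = 1\<close> and \<open>f x0 = 1\<close> are consequences of the
  definition: a maximising sequence for \<open>f\<close> exists and converges to \<open>x0\<close>
  by exposure. Exposure is restated with convergence of the scalar values in place of their real
  parts.\<close>

lemma strongly_exposedE:
  assumes "x0 \<in> strongly_exposed_points smul"
  obtains f where "f \<in> dual smul" "onorm f = 1" "norm x0 = 1" "f x0 = 1"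
    "\<And>x :: nat \<Rightarrow> _. (\<And>n. norm (x n) \<le> 1) \<Longrightarrow> (\<lambda>n. f (x n)) \<longlonglongrightarrow> 1 \<Longrightarrow> x \<longlonglongrightarrow> x0"
proof -
  obtain f where f: "f \<in> dual smul" "onorm f = 1" and x0: "norm x0 \<le> 1"
    and exposed: "\<And>x :: nat \<Rightarrow> _. (\<And>n. norm (x n) \<le> 1) \<Longrightarrow>
      (\<lambda>n. Re (to_complex (f (x n)))) \<longlonglongrightarrow> 1 \<Longrightarrow> x \<longlonglongrightarrow> x0"
    using assms by (fastforce simp: strongly_exposed_points_def)
  have le: "norm (f x) \<le> norm x" for x
    using dual_norm_le[OF f(1)] f(2) by simp
  have bl: "bounded_linear (\<lambda>x. Re (to_complex (f x)))"
    using f(1) by (auto simp: dual_iff intro!: bounded_linear_compose[OF bounded_linear_Re]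
        bounded_linear_compose[OF bounded_linear_to_complex])
  have "\<exists>x. norm x \<le> 1 \<and> 1 - inverse (real (Suc n)) < Re (to_complex (f x))" for n
  proof -
    have "0 \<le> 1 - inverse (real (Suc n))" "1 - inverse (real (Suc n)) < 1"
      by (simp_all add: inverse_le_1_iff)
    then show ?thesis using dual_almost_norming[OF f] by metis
  qed
  then obtain x where x: "\<And>n. norm (x n) \<le> 1"
    "\<And>n. 1 - inverse (real (Suc n)) < Re (to_complex (f (x n)))"
    by metis
  have upper: "Re (to_complex (f (x n))) \<le> 1" for n
    using complex_Re_le_cmod[of "to_complex (f (x n))"] le[of "x n"] x(1)[of n]
    by (simp add: norm_to_complex)
  have lim: "(\<lambda>n. Re (to_complex (f (x n)))) \<longlonglongrightarrow> 1"
  proof (rule tendsto_sandwich)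
    show "(\<lambda>n. 1 - inverse (real (Suc n))) \<longlonglongrightarrow> 1"
      using tendsto_diff[OF tendsto_const LIMSEQ_inverse_real_of_nat, of "1::real"] by simp
    show "\<forall>\<^sub>F n in sequentially. 1 - inverse (real (Suc n)) \<le> Re (to_complex (f (x n)))"
      by (intro always_eventually allI less_imp_le x)
    show "\<forall>\<^sub>F n in sequentially. Re (to_complex (f (x n))) \<le> 1"
      by (intro always_eventually allI upper)
  qed simp
  from bounded_linear.tendsto[OF bl exposed[OF x(1) lim]] lim
  have Re: "Re (to_complex (f x0)) = 1"
    using LIMSEQ_unique by blast
  \<comment> \<open>A number of modulus at most one with real part one is \<open>1\<close>.\<close>
  have norm_le: "cmod (to_complex (f x0)) \<le> 1"
    using le[of x0] x0 by (simp add: norm_to_complex)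
  then have "(Im (to_complex (f x0)))\<^sup>2 \<le> 0"
    using Re power_mono[OF norm_le, of 2] by (simp add: cmod_power2)
  then have "to_complex (f x0) = to_complex (of_real 1 :: 'k)"
    unfolding to_complex_of_real using Re by (simp add: complex_eq_iff)
  then have fx0: "f x0 = 1" by (simp only: to_complex_eq_iff of_real_1)
  show thesis
  proof (rule that[OF f _ fx0])
    show "norm x0 = 1" using x0 le[of x0] fx0 by simp
    fix x :: "nat \<Rightarrow> _"
    assume x: "\<And>n. norm (x n) \<le> 1" and "(\<lambda>n. f (x n)) \<longlonglongrightarrow> 1"
    then have "(\<lambda>n. Re (to_complex (f (x n)))) \<longlonglongrightarrow> Re (to_complex (of_real 1 :: 'k))"
      by (intro tendsto_Re bounded_linear.tendsto[OF bounded_linear_to_complex]) simp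
    then show "x \<longlonglongrightarrow> x0"
      by (intro exposed x) (simp add: to_complex_of_real del: of_real_1)
  qed
qed

section \<open>Operators and the numerical radius\<close>

lemma operators_iff:
  "T \<in> operators smul \<longleftrightarrow>
    (\<forall>x y. T (x + y) = T x + T y) \<and> (\<forall>c x. T (smul c x) = smul c (T x)) \<and> bounded_linear T"
  using vector_space_axioms
  by (auto simp: operators_def Vector_Spaces.linear_def module_hom_iff vector_space_def module_def)

text \<open>Index one makes the radius of \<open>T\<close> at least one, so values above any
  \<open>r < 1\<close> occur. The given state makes the set of values nonempty, and
  \<open>onorm T\<close> bounds it, so supremum and infimum have their usual meaning.\<close>

lemma numerical_radius_witness:
  assumes index: "numerical_index smul = 1" and T: "T \<in> operators smul" "onorm T = 1"
    and state: "g \<in> dual smul" "norm z = 1" "onorm g = 1" "g z = 1" and r: "r < 1"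
  obtains x f where "f \<in> dual smul" "norm x = 1" "onorm f = 1" "f x = 1" "r < norm (f (T x))"
proof -
  define V where
    "V T = {norm (f (T x)) | x f. f \<in> dual smul \<and> norm x = 1 \<and> onorm f = 1 \<and> f x = 1}" for T
  have V_ne: "norm (g (T z)) \<in> V T" for T
    using state by (auto simp: V_def)
  have V_bdd: "bdd_above (V T)" if "T \<in> operators smul" for T
  proof (rule bdd_aboveI)
    fix t assume "t \<in> V T"
    then obtain x f where "t = norm (f (T x))" "f \<in> dual smul" "norm x = 1" "onorm f = 1"
      by (auto simp: V_def)
    then show "t \<le> onorm T"
      using dual_norm_le[of f "T x"] onorm[of T x] that by (simp add: operators_iff)
  qed
  have radius: "numerical_radius smul T = Sup (V T)" for T
    by (simp add: numerical_radius_def V_def)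
  have "0 \<le> numerical_radius smul T" if "T \<in> operators smul" for T
    unfolding radius by (rule cSup_upper2[OF V_ne _ V_bdd[OF that]]) simp
  then have "bdd_below {numerical_radius smul T | T. T \<in> operators smul \<and> onorm T = 1}"
    by (intro bdd_belowI[where m=0]) auto
  then have "numerical_index smul \<le> numerical_radius smul T"
    unfolding numerical_index_def by (rule cInf_lower[rotated]) (use T in blast)
  then have "r < Sup (V T)"
    using index r by (simp add: radius)
  then obtain t where "t \<in> V T" "r < t"
    using V_ne by (metis less_cSupE empty_iff)
  then show thesis using that by (auto simp: V_def)
qed

end

section \<open>Two support functionals at a smooth point that differ at the exposed point\<close>

theorem corollary5p10:
  fixes smul :: "'k::real_or_complex \<Rightarrow> 'a::banach \<Rightarrow> 'a"
    and x0 u0 :: 'a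
  assumes "normed_space_over smul"
    and "x0 \<in> strongly_exposed_points smul"
    and "u0 \<in> smooth_points smul"
    and "birkhoff_james_orthogonal smul u0 x0"
  shows "numerical_index smul \<noteq> 1"
proof
  assume index: "numerical_index smul = 1"
  interpret normed_space_over smul by fact
  obtain f0 where f0: "f0 \<in> dual smul" "onorm f0 = 1" "norm x0 = 1" "f0 x0 = 1"
    and exposed: "\<And>x :: nat \<Rightarrow> _. (\<And>n. norm (x n) \<le> 1) \<Longrightarrow> (\<lambda>n. f0 (x n)) \<longlonglongrightarrow> 1 \<Longrightarrow> x \<longlonglongrightarrow> x0"
    using strongly_exposedE[OF assms(2)] by blast
  have u0: "u0 \<noteq> 0" using smooth_point_nonzero[OF assms(3)] .
  \<comment> \<open>Normalising \<open>u0\<close> gives the rank-one operator \<open>T\<close> the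
    norm of \<open>f0\<close>, which is one.\<close>
  define e where "e = (1 / norm u0) *\<^sub>R u0"
  have e: "norm e = 1" "u0 = norm u0 *\<^sub>R e"
    using u0 by (simp_all add: e_def)
  define T where "T x = smul (f0 x) e" for x
  have norm_T: "norm (T x) = norm (f0 x)" for x
    by (simp add: T_def norm_smul e)
  have "bounded_linear T"
    using f0(1) onorm[of f0] f0(2)
    by (intro bounded_linear_intro[where K=1])
      (auto simp: norm_T, auto simp: T_def dual_iff linear_simps scale_left_distrib smul_scaleR_left)
  then have T: "T \<in> operators smul"
    using f0(1) by (simp add: operators_iff T_def dual_iff scale_left_distrib)
  have T1: "onorm T = 1"
    using f0(2) by (simp add: onorm_def norm_T)
  have "\<exists>x f. f \<in> dual smul \<and> norm x = 1 \<and> onorm f = 1 \<and> f x = 1 \<and>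
      1 - inverse (real (Suc n)) < norm (f (T x))" for n
    using numerical_radius_witness[OF index T T1 f0(1,3,2,4), of "1 - inverse (real (Suc n))"]
    by (metis diff_less_eq inverse_positive_iff_positive less_add_same_cancel1 of_nat_0_less_iff
        zero_less_Suc)
  then obtain x f where f: "\<And>n. f n \<in> dual smul" "\<And>n. onorm (f n) = 1"
    and x: "\<And>n. norm (x n) = 1" "\<And>n. f n (x n) = 1"
    and fTx: "\<And>n. 1 - inverse (real (Suc n)) < norm (f n (T (x n)))"
    by metis
  have f_le: "norm (f n z) \<le> norm z" for n z
    using dual_norm_le[OF f(1)] f(2) by simp
  have f_lin: "f n (a + b) = f n a + f n b" "f n (smul c a) = c * f n a" for n a b c
    using f(1) by (simp_all add: dual_iff)
  have f0x_le: "norm (f0 (x n)) \<le> 1" for n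
    using dual_norm_le[OF f0(1), of "x n"] f0(2) x(1) by simp
  have fe_le: "norm (f n e) \<le> 1" for n
    using f_le[of n e] e by simp
  have fTx_eq: "norm (f n (T (x n))) = norm (f0 (x n)) * norm (f n e)" for n
    by (simp add: T_def f_lin norm_mult)
  \<comment> \<open>To be applied to the two factors in \<open>fTx_eq\<close>: each is at most one
    and at least their product, which tends to one.\<close>
  have lim1: "a \<longlonglongrightarrow> 1" if "\<And>n. norm (f n (T (x n))) \<le> a n" "\<And>n. a n \<le> 1" for a :: "nat \<Rightarrow> real"
  proof (rule tendsto_sandwich)
    show "(\<lambda>n. 1 - inverse (real (Suc n))) \<longlonglongrightarrow> 1"
      using tendsto_diff[OF tendsto_const LIMSEQ_inverse_real_of_nat, of "1::real"] by simp
    show "\<forall>\<^sub>F n in sequentially. 1 - inverse (real (Suc n)) \<le> a n"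
      using fTx that(1) by (intro always_eventually allI) (meson less_imp_le order_trans)
    show "\<forall>\<^sub>F n in sequentially. a n \<le> 1"
      using that(2) by simp
  qed simp
  have f0x_lim: "(\<lambda>n. norm (f0 (x n))) \<longlonglongrightarrow> 1"
    by (rule lim1) (simp_all add: fTx_eq f0x_le fe_le mult_left_le)
  have fe_lim: "(\<lambda>n. norm (f n e)) \<longlonglongrightarrow> 1"
    by (rule lim1) (simp_all add: fTx_eq f0x_le fe_le mult_left_le_one_le)
  \<comment> \<open>Exposure needs values of \<open>f0\<close> tending to \<open>1\<close>, whereas
    only their moduli are known to; the phases \<open>c n\<close> make up for this.\<close>
  have "\<exists>c. norm c = 1 \<and> c * f0 (x n) = of_real (norm (f0 (x n)))" for n
    using ex_rotation by metis
  then obtain c where c: "\<And>n. norm (c n) = 1" "\<And>n. c n * f0 (x n) = of_real (norm (f0 (x n)))"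
    by metis
  have y_lim: "(\<lambda>n. smul (c n) (x n)) \<longlonglongrightarrow> x0"
  proof (rule exposed)
    show "norm (smul (c n) (x n)) \<le> 1" for n
      by (simp add: norm_smul c x)
    have "(\<lambda>n. of_real (norm (f0 (x n))) :: 'k) \<longlonglongrightarrow> of_real 1"
      by (rule tendsto_of_real[OF f0x_lim])
    then show "(\<lambda>n. f0 (smul (c n) (x n))) \<longlonglongrightarrow> 1"
      using f0(1) by (simp add: dual_iff c)
  qed
  have fx0_lim: "(\<lambda>n. norm (f n x0)) \<longlonglongrightarrow> 1"
  proof (rule tendsto_sandwich)
    have "(\<lambda>n. 1 - norm (smul (c n) (x n) - x0)) \<longlonglongrightarrow> 1 - 0"
      by (intro tendsto_diff tendsto_const tendsto_norm_zero LIM_zero y_lim)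
    then show "(\<lambda>n. 1 - norm (smul (c n) (x n) - x0)) \<longlonglongrightarrow> 1" by simp
    \<comment> \<open>\<open>f n\<close> takes the value \<open>c n\<close>, of modulus one, at
      \<open>smul (c n) (x n)\<close>, which is close to \<open>x0\<close>.\<close>
    have "1 - norm (smul (c n) (x n) - x0) \<le> norm (f n x0)" for n
    proof -
      have "f n (smul (c n) (x n) - x0) + f n x0 = c n"
        using f_lin(1)[of n "smul (c n) (x n) - x0" x0] by (simp add: f_lin(2) x)
      then have "1 \<le> norm (f n (smul (c n) (x n) - x0)) + norm (f n x0)"
        using norm_triangle_ineq c(1) by metis
      then show ?thesis using f_le[of n "smul (c n) (x n) - x0"] by simp
    qed
    then show "\<forall>\<^sub>F n in sequentially. 1 - norm (smul (c n) (x n) - x0) \<le> norm (f n x0)"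
      by simp
    show "\<forall>\<^sub>F n in sequentially. norm (f n x0) \<le> 1"
      using f_le f0(3) by (metis (mono_tags, lifting) always_eventually)
  qed simp
  \<comment> \<open>The phases \<open>d n\<close> make the values at \<open>e\<close> nonnegative,
    hence convergent to \<open>1\<close>; the values at \<open>x0\<close> then converge along a
    subsequence.\<close>
  have "\<exists>d. norm d = 1 \<and> d * f n e = of_real (norm (f n e))" for n
    using ex_rotation by metis
  then obtain d where d: "\<And>n. norm (d n) = 1" "\<And>n. d n * f n e = of_real (norm (f n e))"
    by metis
  have "norm (d n * f n x0) \<le> 1" for n
    using f_le[of n x0] f0(3) by (simp add: norm_mult d)
  then obtain s l where s: "strict_mono s" and l: "(\<lambda>n. d (s n) * f (s n) x0) \<longlonglongrightarrow> l"
    using real_or_complex_bounded_subsequence[of "\<lambda>n. d n * f n x0"] by blast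
  have "(\<lambda>n. norm (d (s n) * f (s n) x0)) \<longlonglongrightarrow> 1"
    using LIMSEQ_subseq_LIMSEQ[OF fx0_lim s] by (simp add: norm_mult d o_def)
  with tendsto_norm[OF l] have "norm l = 1"
    using LIMSEQ_unique by blast
  have "(\<lambda>n. of_real (norm (f (s n) e)) :: 'k) \<longlonglongrightarrow> of_real 1"
    using LIMSEQ_subseq_LIMSEQ[OF fe_lim s] by (intro tendsto_of_real) (simp add: o_def)
  then have e_lim: "(\<lambda>n. d (s n) * f (s n) e) \<longlonglongrightarrow> 1"
    by (simp add: d)
  \<comment> \<open>The norm bounds of the rotated \<open>f (s n)\<close> pass to the limit on the
    span of \<open>e\<close> and \<open>x0\<close>, which is what the extension to \<psi>
    requires.\<close>
  have "norm (a * 1 + b * l) \<le> norm (smul a e + smul b x0)" for a b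
  proof (rule LIMSEQ_le_const2)
    show "(\<lambda>n. norm (a * (d (s n) * f (s n) e) + b * (d (s n) * f (s n) x0)))
        \<longlonglongrightarrow> norm (a * 1 + b * l)"
      by (intro tendsto_intros e_lim l)
    have "norm (a * (d n * f n e) + b * (d n * f n x0)) \<le> norm (smul a e + smul b x0)" for n
    proof -
      have "a * (d n * f n e) + b * (d n * f n x0) = d n * f n (smul a e + smul b x0)"
        by (simp add: f_lin algebra_simps)
      then show ?thesis using f_le by (simp add: norm_mult d)
    qed
    then show "\<exists>N. \<forall>n\<ge>N. norm (a * (d (s n) * f (s n) e) + b * (d (s n) * f (s n) x0))
        \<le> norm (smul a e + smul b x0)"
      by blast
  qed
  from ex_dual_two_values[OF this] obtain \<psi> where \<psi>: "\<psi> \<in> dual smul"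
      "\<And>x. norm (\<psi> x) \<le> norm x" "\<psi> e = 1" "\<psi> x0 = l"
    by metis
  have \<psi>1: "onorm \<psi> = 1"
    by (rule dual_onorm_eq_oneI[of \<psi> e]) (use \<psi> e in auto)
  have "\<psi> u0 = norm u0 *\<^sub>R \<psi> e"
    using \<psi>(1) linear_scale[OF bounded_linear.linear, of \<psi> "norm u0" e] e(2)
    by (simp add: dual_iff)
  then have \<psi>u0: "\<psi> u0 = of_real (norm u0)"
    by (simp add: \<psi> scaleR_conv_of_real)
  obtain \<phi> where \<phi>: "\<phi> \<in> dual smul" "onorm \<phi> = 1" "\<phi> u0 = of_real (norm u0)" "\<phi> x0 = 0"
    using birkhoff_james_support[OF assms(4) u0] by blast
  obtain h where h: "{f \<in> dual smul. onorm f = 1 \<and> f u0 = of_real (norm u0)} = {h}"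
    using assms(3) by (auto simp: smooth_points_def is_singleton_def)
  \<comment> \<open>Smoothness of \<open>u0\<close> identifies the two functionals, yet at
    \<open>x0\<close> one vanishes and the other has modulus one.\<close>
  have "\<phi> \<in> {h}" "\<psi> \<in> {h}"
    using \<phi> \<psi>(1) \<psi>1 \<psi>u0 by (simp_all flip: h)
  then have "\<phi> = \<psi>" by simp
  with \<phi>(4) \<psi>(4) \<open>norm l = 1\<close> show False by simp
qed

end
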